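(* Let $M$ be a monoid with identity $1$ such that $E(M)\subseteq Z(M)$ and let $s(x,y)=(xy,\theta_x(y))$ be an idempotent solution on $M$. Then the map $\theta_1$ is an idempotent monoid homomorphism from $M$ to $E(M)$.
   Context: For a semigroup $X$, a solution (set-theoretical solution of the pentagon equation) on $X$ is a map $s:X\times X\to X\times X$ of the form $s(x,y)=(xy,\theta_x(y))$, where $xy$ is the product in $X$ and $\theta_x:X\to X$ is a map for every $x\in X$, such that for all $x,y,z\in X$: $\theta_x(y)\,\theta_{xy}(z)=\theta_x(yz)$ and $\theta_{\theta_x(y)}\theta_{xy}=\theta_y$ (juxtaposition of maps is composition). The solution $s$ is idempotent if $s^2=s$. $E(M)$ denotes the set of idempotents of $M$ and $Z(M)$ the center of $M$. A map $\theta_1$ is idempotent if $\theta_1\theta_1=\theta_1$. *)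

theory Defs
  imports "HOL-Algebra.Group"
begin

definition idempotents :: "('a, 'b) monoid_scheme \<Rightarrow> 'a set" where
  "idempotents G = {e \<in> carrier G. e \<otimes>\<^bsub>G\<^esub> e = e}"

definition center :: "('a, 'b) monoid_scheme \<Rightarrow> 'a set" where
  "center G = {z \<in> carrier G. \<forall>x \<in> carrier G. z \<otimes>\<^bsub>G\<^esub> x = x \<otimes>\<^bsub>G\<^esub> z}"

definition idempotent_on :: "'a set \<Rightarrow> ('a \<Rightarrow> 'a) \<Rightarrow> bool" where
  "idempotent_on A f \<longleftrightarrow> f \<in> A \<rightarrow> A \<and> (\<forall>x \<in> A. f (f x) = f x)"

(* Only the multiplication of X is used, so the definition makes sense for semigroups. It
   constrains the values of s and \<theta> on the carrier only; in particular, the identity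
   \<theta>_{\<theta>_x(y)} \<theta>_{xy} = \<theta>_y between self-maps of X is required pointwise on the carrier. *)
definition pentagon_solution ::
  "('a, 'b) monoid_scheme \<Rightarrow> ('a \<times> 'a \<Rightarrow> 'a \<times> 'a) \<Rightarrow> ('a \<Rightarrow> 'a \<Rightarrow> 'a) \<Rightarrow> bool" where
  "pentagon_solution X s \<theta> \<longleftrightarrow>
     (\<forall>x \<in> carrier X. \<theta> x \<in> carrier X \<rightarrow> carrier X) \<and>
     (\<forall>x \<in> carrier X. \<forall>y \<in> carrier X. s (x, y) = (x \<otimes>\<^bsub>X\<^esub> y, \<theta> x y)) \<and>
     (\<forall>x \<in> carrier X. \<forall>y \<in> carrier X. \<forall>z \<in> carrier X.
        \<theta> x y \<otimes>\<^bsub>X\<^esub> \<theta> (x \<otimes>\<^bsub>X\<^esub> y) z = \<theta> x (y \<otimes>\<^bsub>X\<^esub> z)) \<and>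
     (\<forall>x \<in> carrier X. \<forall>y \<in> carrier X. \<forall>z \<in> carrier X.
        \<theta> (\<theta> x y) (\<theta> (x \<otimes>\<^bsub>X\<^esub> y) z) = \<theta> y z)"

(* The library's hom does not require preservation of the identity. *)
definition monoid_hom :: "('a, 'c) monoid_scheme \<Rightarrow> ('b, 'd) monoid_scheme \<Rightarrow> ('a \<Rightarrow> 'b) set" where
  "monoid_hom G H = {h \<in> hom G H. h \<one>\<^bsub>G\<^esub> = \<one>\<^bsub>H\<^esub>}"

end

theory Submission
  imports Defs
begin

text \<open>
  Write \<open>f = \<theta>\<^sub>1\<close>. Idempotency of the solution means \<open>xy \<theta>\<^sub>x(y) = xy\<close> and
  \<open>\<theta>\<^bsub>xy\<^esub>(\<theta>\<^sub>x(y)) = \<theta>\<^sub>x(y)\<close>. Specialising this and the pentagon laws to \<open>x = 1\<close> gives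
  \<open>y f(y) = y\<close>, \<open>\<theta>\<^sub>y(f(y)) = f(y)\<close> and \<open>f(y) \<theta>\<^sub>y(z) = f(yz)\<close>. Hence \<open>f(1) = 1\<close>, \<open>f\<close> is idempotent
  as a map, and every value of \<open>f\<close> is an idempotent element, thus central.

  Multiplicativity comes from the absorption law \<open>f(xz) = f(f(x) z)\<close>. It holds because
  \<open>\<theta>\<^sub>x(f(x) z) = \<theta>\<^sub>x(f(x)) \<theta>\<^bsub>x f(x)\<^esub>(z) = f(x) \<theta>\<^sub>x(z) = f(xz)\<close>, while applying \<open>f\<close> to a value of
  \<open>\<theta>\<^sub>x\<close> nearly forgets \<open>\<theta>\<^sub>x\<close>: one has \<open>f(\<theta>\<^sub>x(w)) = f(\<theta>\<^sub>x(1)) f(w)\<close>, and the factor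
  \<open>f(\<theta>\<^sub>x(1))\<close> is absorbed by \<open>f(x)\<close>. As \<open>f(x)\<close> is central, the law can be used a second time
  on the other factor: \<open>f(xz) = f(z f(x)) = f(f(z) f(x))\<close>. Finally a product of two values of
  \<open>f\<close> is again fixed by \<open>f\<close>, so that \<open>f(xz) = f(x) f(z)\<close>.
\<close>

lemma (in monoid) submonoid_idempotents:
  assumes "idempotents G \<subseteq> center G"
  shows "submonoid (idempotents G) G"
proof
  show "idempotents G \<subseteq> carrier G"
    by (auto simp: idempotents_def)
  show "\<one> \<in> idempotents G"
    by (simp add: idempotents_def)
  fix x y assume x: "x \<in> idempotents G" and y: "y \<in> idempotents G"
  then have c: "x \<in> carrier G" "y \<in> carrier G" and i: "x \<otimes> x = x" "y \<otimes> y = y"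
    by (auto simp: idempotents_def)
  have "y \<otimes> x = x \<otimes> y"
    using assms y c by (auto simp: center_def)
  then have "(x \<otimes> y) \<otimes> (x \<otimes> y) = (x \<otimes> x) \<otimes> (y \<otimes> y)"
    using c by (metis m_assoc m_closed)
  then show "x \<otimes> y \<in> idempotents G"
    using c i by (simp add: idempotents_def)
qed

text \<open>
  Idempotency of the solution is unfolded into its two components, so that all the assumptions
  become equations in the monoid.
\<close>

locale idempotent_pentagon_monoid = monoid M for M (structure) +
  fixes \<theta> :: "'a \<Rightarrow> 'a \<Rightarrow> 'a"
  assumes idempotents_central: "idempotents M \<subseteq> center M"
    and theta_closed [simp]: "\<lbrakk>x \<in> carrier M; y \<in> carrier M\<rbrakk> \<Longrightarrow> \<theta> x y \<in> carrier M"
    and theta_mult: "\<lbrakk>x \<in> carrier M; y \<in> carrier M; z \<in> carrier M\<rbrakk> \<Longrightarrow>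
          \<theta> x y \<otimes> \<theta> (x \<otimes> y) z = \<theta> x (y \<otimes> z)"
    and theta_comp: "\<lbrakk>x \<in> carrier M; y \<in> carrier M; z \<in> carrier M\<rbrakk> \<Longrightarrow>
          \<theta> (\<theta> x y) (\<theta> (x \<otimes> y) z) = \<theta> y z"
    and mult_theta: "\<lbrakk>x \<in> carrier M; y \<in> carrier M\<rbrakk> \<Longrightarrow> x \<otimes> y \<otimes> \<theta> x y = x \<otimes> y"
    and theta_fixed: "\<lbrakk>x \<in> carrier M; y \<in> carrier M\<rbrakk> \<Longrightarrow> \<theta> (x \<otimes> y) (\<theta> x y) = \<theta> x y"
begin

abbreviation f :: "'a \<Rightarrow> 'a" where
  "f \<equiv> \<theta> \<one>"

lemma mult_f: "x \<in> carrier M \<Longrightarrow> x \<otimes> f x = x"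
  using mult_theta[of \<one> x] by simp

lemma theta_f: "x \<in> carrier M \<Longrightarrow> \<theta> x (f x) = f x"
  using theta_fixed[of \<one> x] by simp

lemma f_mult_theta: "\<lbrakk>x \<in> carrier M; y \<in> carrier M\<rbrakk> \<Longrightarrow> f x \<otimes> \<theta> x y = f (x \<otimes> y)"
  using theta_mult[of \<one> x y] by simp

lemma f_one: "f \<one> = \<one>"
  using mult_f[of \<one>] by simp

lemma f_f: "x \<in> carrier M \<Longrightarrow> f (f x) = f x"
  using theta_comp[of \<one> \<one> x] by (simp add: f_one)

lemma f_idem: "x \<in> carrier M \<Longrightarrow> f x \<otimes> f x = f x"
  using f_mult_theta[of x "f x"] by (simp add: theta_f mult_f)

lemma f_idempotents: "x \<in> carrier M \<Longrightarrow> f x \<in> idempotents M"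
  by (simp add: idempotents_def f_idem)

lemma f_central: "\<lbrakk>x \<in> carrier M; y \<in> carrier M\<rbrakk> \<Longrightarrow> f x \<otimes> y = y \<otimes> f x"
  using f_idempotents[of x] idempotents_central by (auto simp: center_def)

text \<open>
  With \<open>g = \<theta>\<^sub>x(1)\<close>, the composition law gives \<open>\<theta>\<^sub>g \<theta>\<^sub>x = f\<close>, and \<open>g\<close> is a left identity for the
  values of \<open>\<theta>\<^sub>x\<close>, so \<open>f(\<theta>\<^sub>x(z)) = f(g \<theta>\<^sub>x(z)) = f(g) \<theta>\<^sub>g(\<theta>\<^sub>x(z)) = f(g) f(z)\<close>.
\<close>

lemma f_theta:
  assumes "x \<in> carrier M" "z \<in> carrier M"
  shows "f (\<theta> x z) = f (\<theta> x \<one>) \<otimes> f z"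
proof -
  have "\<theta> x \<one> \<otimes> \<theta> x z = \<theta> x z"
    using theta_mult[of x \<one> z] assms by simp
  moreover have "\<theta> (\<theta> x \<one>) (\<theta> x z) = f z"
    using theta_comp[of x \<one> z] assms by simp
  ultimately show ?thesis
    using f_mult_theta[of "\<theta> x \<one>" "\<theta> x z"] assms by simp
qed

text \<open>
  The element \<open>f(x)\<close> equals \<open>f(x) \<theta>\<^sub>x(1) = \<theta>\<^sub>x(1) f(x)\<close>, so \<open>f\<close> maps it to an element of the
  form \<open>f(\<theta>\<^sub>x(1)) w\<close>, on which the idempotent \<open>f(\<theta>\<^sub>x(1))\<close> acts as identity; but \<open>f\<close> fixes \<open>f(x)\<close>.
\<close>

lemma f_theta_one_absorb:
  assumes x: "x \<in> carrier M"
  shows "f (\<theta> x \<one>) \<otimes> f x = f x"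
proof -
  let ?g = "\<theta> x \<one>"
  have "?g \<otimes> f x = f x"
    using f_mult_theta[of x \<one>] f_central[of x ?g] x by simp
  then have fx: "f x = f ?g \<otimes> \<theta> ?g (f x)"
    using f_mult_theta[of ?g "f x"] x by (simp add: f_f)
  have "f ?g \<otimes> f x = f ?g \<otimes> (f ?g \<otimes> \<theta> ?g (f x))"
    using fx by simp
  also have "\<dots> = f ?g \<otimes> \<theta> ?g (f x)"
    using x by (simp add: m_assoc[symmetric] f_idem)
  finally show ?thesis
    using fx by simp
qed

text \<open>
  The key is that \<open>\<theta>\<^sub>x\<close> and \<open>f\<close> are linked by \<open>\<theta>\<^sub>x(f(x) z) = f(xz)\<close>; applying the idempotent
  map \<open>f\<close> to both sides brings in the description of \<open>f(\<theta>\<^sub>x(w))\<close> at \<open>w = f(x) z\<close>.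
\<close>

lemma f_mult_absorb:
  assumes x: "x \<in> carrier M" and z: "z \<in> carrier M"
  shows "f (x \<otimes> z) = f (f x \<otimes> z)"
proof -
  have fz: "f (f x \<otimes> z) = f x \<otimes> \<theta> (f x) z"
    using f_mult_theta[of "f x" z] x z by (simp add: f_f)
  have "\<theta> x (f x \<otimes> z) = f (x \<otimes> z)"
    using theta_mult[of x "f x" z] x z by (simp add: theta_f mult_f f_mult_theta)
  then have "f (x \<otimes> z) = f (\<theta> x (f x \<otimes> z))"
    using x z by (simp add: f_f)
  also have "\<dots> = f (\<theta> x \<one>) \<otimes> f (f x \<otimes> z)"
    using x z by (intro f_theta) auto
  also have "\<dots> = f (f x \<otimes> z)"
    using x z by (simp add: fz m_assoc[symmetric] f_theta_one_absorb)
  finally show ?thesis .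
qed

text \<open>
  For \<open>e = f(x)\<close> and \<open>k = f(y)\<close>, the element \<open>f(ek) = f(ke)\<close> is of the form \<open>e u\<close> and also of the
  form \<open>k v\<close>, so the idempotents \<open>e\<close> and \<open>k\<close> both act on it as identity. Thus \<open>ek f(ek) = f(ek)\<close>, whereas \<open>ek f(ek) = ek\<close> always holds.
\<close>

lemma f_fixes_product_of_values:
  assumes x: "x \<in> carrier M" and y: "y \<in> carrier M"
  shows "f (f x \<otimes> f y) = f x \<otimes> f y"
proof -
  let ?p = "f (f x \<otimes> f y)"
  have absorb: "f a \<otimes> f (f a \<otimes> b) = f (f a \<otimes> b)"
    if a: "a \<in> carrier M" and b: "b \<in> carrier M" for a b
  proof -
    have "f (f a \<otimes> b) = f a \<otimes> \<theta> (f a) b"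
      using f_mult_theta[of "f a" b] a b by (simp add: f_f)
    then show ?thesis
      using a b by (simp add: m_assoc[symmetric] f_idem)
  qed
  have "f y \<otimes> ?p = ?p"
    using absorb[of y "f x"] f_central[of x "f y"] x y by simp
  then have "f x \<otimes> f y \<otimes> ?p = ?p"
    using absorb[of x "f y"] x y by (simp add: m_assoc)
  then show ?thesis
    using mult_f[of "f x \<otimes> f y"] x y by simp
qed

lemma f_mult:
  assumes x: "x \<in> carrier M" and z: "z \<in> carrier M"
  shows "f (x \<otimes> z) = f x \<otimes> f z"
proof -
  have "f (x \<otimes> z) = f (z \<otimes> f x)"
    using f_mult_absorb[OF x z] f_central[OF x z] by simp
  also have "\<dots> = f (f z \<otimes> f x)"
    using x z by (intro f_mult_absorb) auto
  also have "\<dots> = f x \<otimes> f z"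
    using f_fixes_product_of_values[OF z x] f_central[of z "f x"] x z by simp
  finally show ?thesis .
qed

end

theorem proposition17:
  fixes M :: "('a, 'b) monoid_scheme"
    and s :: "'a \<times> 'a \<Rightarrow> 'a \<times> 'a"
    and \<theta> :: "'a \<Rightarrow> 'a \<Rightarrow> 'a"
  assumes "monoid M"
    and "idempotents M \<subseteq> center M"
    and "pentagon_solution M s \<theta>"
    and "idempotent_on (carrier M \<times> carrier M) s"
  shows "submonoid (idempotents M) M \<and>
         \<theta> \<one>\<^bsub>M\<^esub> \<in> monoid_hom M (M\<lparr>carrier := idempotents M\<rparr>) \<and>
         idempotent_on (carrier M) (\<theta> \<one>\<^bsub>M\<^esub>)"
proof -
  interpret monoid M by fact
  have closed: "\<And>x y. \<lbrakk>x \<in> carrier M; y \<in> carrier M\<rbrakk> \<Longrightarrow> \<theta> x y \<in> carrier M"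
    and s: "\<And>x y. \<lbrakk>x \<in> carrier M; y \<in> carrier M\<rbrakk> \<Longrightarrow> s (x, y) = (x \<otimes>\<^bsub>M\<^esub> y, \<theta> x y)"
    using assms(3) by (auto simp: pentagon_solution_def)
  have ss: "x \<otimes>\<^bsub>M\<^esub> y \<otimes>\<^bsub>M\<^esub> \<theta> x y = x \<otimes>\<^bsub>M\<^esub> y \<and> \<theta> (x \<otimes>\<^bsub>M\<^esub> y) (\<theta> x y) = \<theta> x y"
    if "x \<in> carrier M" "y \<in> carrier M" for x y
  proof -
    have "s (s (x, y)) = s (x, y)"
      using assms(4) that by (auto simp: idempotent_on_def)
    then show ?thesis
      using that by (simp add: s closed)
  qed
  interpret idempotent_pentagon_monoid M \<theta>
    by unfold_locales (use assms(2,3) closed ss in \<open>auto simp: pentagon_solution_def\<close>)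
  show ?thesis
    using submonoid_idempotents[OF assms(2)]
    by (auto simp: monoid_hom_def hom_def idempotent_on_def f_idempotents f_mult f_one f_f)
qed

end
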